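(* For every permutation pattern $p$ and every integer $k\ge |p|$, $$\lim_{n\to\infty}\bigl(\mathrm{op}_{n,k}(p)\bigr)^{1/n}=|p|-1.$$
   Context: A permutation pattern is a permutation $p=p_1\cdots p_m$ of $[m]=\{1,\dots,m\}$ for some $m\ge1$; its length is $|p|=m$. An ordered partition of $[n]$ into $k$ blocks is a sequence $\pi=B_1/B_2/\cdots/B_k$ of nonempty pairwise disjoint subsets with union $[n]$. Such $\pi$ contains $p$ if there exist integers $1\le i_1<\cdots<i_m\le k$ and elements $b_j\in B_{i_j}$ ($1\le j\le m$) such that $b_1\cdots b_m$ is order isomorphic to $p$ (i.e. $b_s<b_t\iff p_s<p_t$); otherwise $\pi$ avoids $p$. $\mathrm{op}_{n,k}(p)$ is the number of ordered partitions of $[n]$ into $k$ blocks that avoid $p$. *)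

theory Defs
  imports Complex_Main "HOL-Library.Disjoint_Sets" "HOL-Combinatorics.Multiset_Permutations"
begin

text \<open>A permutation \<open>p\<^sub>1 \<dots> p\<^sub>m\<close> of \<open>{1..m}\<close> is given in one-line notation, as a list of
  length \<open>m\<close>; list positions count from 0.\<close>

definition is_pattern :: "nat list \<Rightarrow> bool" where
  "is_pattern p \<longleftrightarrow> length p \<ge> 1 \<and> p \<in> permutations_of_set {1..length p}"

text \<open>Since \<^const>\<open>partition_on\<close> only sees the set of blocks, \<^const>\<open>distinct\<close> is needed for
  blocks at different positions to be disjoint.\<close>

definition ordered_partitions :: "nat \<Rightarrow> nat \<Rightarrow> nat set list set" where
  "ordered_partitions n k = {B. length B = k \<and> distinct B \<and> partition_on {1..n} (set B)}"

definition contains_pattern :: "nat set list \<Rightarrow> nat list \<Rightarrow> bool" where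
  "contains_pattern B p \<longleftrightarrow>
     (\<exists>(i :: nat \<Rightarrow> nat) (b :: nat \<Rightarrow> nat).
        strict_mono_on {..<length p} i \<and>
        (\<forall>j<length p. i j < length B \<and> b j \<in> B ! i j) \<and>
        (\<forall>s<length p. \<forall>t<length p. b s < b t \<longleftrightarrow> p ! s < p ! t))"

definition op_count :: "nat \<Rightarrow> nat \<Rightarrow> nat list \<Rightarrow> nat" where
  "op_count n k p = card {B \<in> ordered_partitions n k. \<not> contains_pattern B p}"

text \<open>The set counted above is finite, so its \<^const>\<open>card\<close> is the actual number of elements.\<close>

lemma finite_ordered_partitions: "finite (ordered_partitions n k)"
proof (rule finite_subset)
  show "ordered_partitions n k \<subseteq> {B. set B \<subseteq> Pow {1..n} \<and> length B = k}"
    by (auto simp: ordered_partitions_def partition_on_def)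
  show "finite {B. set B \<subseteq> Pow {1..n} \<and> length B = k}"
    by (rule finite_lists_length_eq) simp
qed

end

theory Submission
  imports Defs "HOL-Library.Sublist"
begin

text \<open>
  An ordered partition of \<open>{1..n}\<close> into \<open>k\<close> blocks is the same thing as a word of length \<open>n\<close>
  over the alphabet \<open>{..<k}\<close> that uses every letter: position \<open>x\<close> carries the index of the
  block of \<open>x\<close>.  Under this correspondence the partition contains \<open>p\<close> exactly if the word has a
  subsequence that is order isomorphic to the inverse permutation of \<open>p\<close>.  Put \<open>m = length p\<close>.
  The number of avoiding words is shown to be \<open>(m - 1)\<^sup>n\<close> up to subexponential factors.

  Upper bound.  Read a word from left to right and remember which sequences of length at
  most \<open>m\<close> occur in it as subsequences.  This memory can only grow, and it can grow only a bounded
  number of times.  A letter is redundant at some moment if reading it leaves the memory unchanged.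
  If a set of \<open>m\<close> letters were redundant at the same moment, they could be read one after
  another in any order without changing the memory; in a suitable order they spell the forbidden
  subsequence, which therefore occurred already (lemma \<open>few_redundant_letters\<close>).  So in an avoiding
  word all but boundedly many steps have at most \<open>m - 1\<close> choices, which gives a bound
  \<open>C * (m - 1 + e)\<^sup>n\<close> for every \<open>e > 0\<close> (lemma \<open>card_avoiding_words_le\<close>).

  Lower bound.  For \<open>m = 1\<close> it is trivial.  For \<open>m \<ge> 2\<close>, let \<open>v\<close> be any word over the first \<open>m - 1\<close> letters.  The last letter
  of an occurrence of \<open>p\<close>, in the order of the blocks, is at least \<open>m - 1\<close> and so is not in \<open>v\<close>.
  Insert all \<open>k\<close> letters in decreasing order in front of \<open>v\<close> if \<open>p\<close> ends above its first entry,
  and in increasing order behind \<open>v\<close> if it ends below.  Then the first entry of \<open>p\<close> is matched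
  in the inserted monotone part too, which runs the wrong way (lemmas \<open>avoids_decreasing_prefix\<close>
  and \<open>avoids_increasing_suffix\<close>).  This produces \<open>(m - 1)\<close> to the power \<open>n - k\<close> avoiding
  partitions.
\<close>

section \<open>Growth rates from two-sided exponential bounds\<close>

lemma root_tendsto_growth_rate:
  fixes a :: "nat \<Rightarrow> real"
  assumes "L \<ge> 0"
    and "c > 0" and lower: "\<forall>\<^sub>F n in sequentially. c * L ^ n \<le> a n"
    and upper: "\<And>r. r > L \<Longrightarrow> \<exists>C>0. \<forall>n. a n \<le> C * r ^ n"
  shows "(\<lambda>n. root n (a n)) \<longlonglongrightarrow> L"
proof -
  \<comment> \<open>Constant factors disappear under the \<open>n\<close>-th root.\<close>
  have lim: "(\<lambda>n. root n (C * r ^ n)) \<longlonglongrightarrow> r" if "C > 0" "r \<ge> 0" for C r :: real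
  proof -
    have "\<forall>\<^sub>F n in sequentially. root n C * r = root n (C * r ^ n)"
      using eventually_gt_at_top[of 0]
      by eventually_elim (use that in \<open>simp add: real_root_mult real_root_power_cancel\<close>)
    moreover have "(\<lambda>n. root n C * r) \<longlonglongrightarrow> 1 * r"
      by (intro tendsto_mult LIMSEQ_root_const tendsto_const that)
    ultimately show ?thesis
      using Lim_transform_eventually by fastforce
  qed
  show ?thesis
  proof (rule order_tendstoI)
    fix x assume "x < L"
    have "\<forall>\<^sub>F n in sequentially. x < root n (c * L ^ n)"
      using order_tendstoD(1)[OF lim[OF assms(2,1)] \<open>x < L\<close>] .
    then show "\<forall>\<^sub>F n in sequentially. x < root n (a n)"
      using lower eventually_gt_at_top[of 0]
    proof eventually_elim
      case (elim n)
      then show ?case using real_root_le_mono[of n "c * L ^ n" "a n"] by linarith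
    qed
  next
    fix x assume "L < x"
    then obtain r where r: "L < r" "r < x" using dense by blast
    obtain C where C: "C > 0" "\<And>n. a n \<le> C * r ^ n" using upper[OF r(1)] by blast
    have "\<forall>\<^sub>F n in sequentially. root n (C * r ^ n) < x"
      using order_tendstoD(2)[OF lim[OF C(1), of r] r(2)] r(1) \<open>L \<ge> 0\<close> by simp
    then show "\<forall>\<^sub>F n in sequentially. root n (a n) < x"
      using eventually_gt_at_top[of 0]
    proof eventually_elim
      case (elim n)
      then show ?case using real_root_le_mono[OF _ C(2)[of n]] by (meson le_less_trans)
    qed
  qed
qed

section \<open>Counting words that avoid a set of subsequences\<close>

text \<open>The memory of a reader of the word \<open>u\<close>.  What it becomes after one more letter depends only
  on its present value and on that letter.\<close>

definition short_subseqs :: "nat \<Rightarrow> 'a list \<Rightarrow> 'a list set" where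
  "short_subseqs m u = {t. subseq t u \<and> length t \<le> m}"

definition avoiding_extensions :: "'a set \<Rightarrow> 'a list set \<Rightarrow> 'a list \<Rightarrow> nat \<Rightarrow> 'a list set" where
  "avoiding_extensions A P u n =
     {v. set v \<subseteq> A \<and> length v = n \<and> (\<forall>t\<in>P. \<not> subseq t (u @ v))}"

lemma short_subseqs_snoc_mono: "short_subseqs m u \<subseteq> short_subseqs m (u @ [a])"
  by (auto simp: short_subseqs_def intro: subseq_order.trans)

lemma finite_avoiding_extensions: "finite A \<Longrightarrow> finite (avoiding_extensions A P u n)"
  by (rule finite_subset[OF _ finite_lists_length_eq[of A n]]) (auto simp: avoiding_extensions_def)

text \<open>Appending a redundant letter to a subsequence of \<open>u\<close> gives a subsequence of \<open>u @ [a]\<close>,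
  hence one of \<open>u\<close> itself.  So anything spelled with redundant letters is found in \<open>u\<close>.\<close>

lemma subseq_of_redundant_letters:
  assumes "\<And>a. a \<in> set t \<Longrightarrow> short_subseqs m (u @ [a]) = short_subseqs m u"
    and "length t \<le> m"
  shows "subseq t u"
  using assms
proof (induction t rule: rev_induct)
  case Nil
  then show ?case by simp
next
  case (snoc a s)
  have "subseq s u" using snoc by simp
  then have "s @ [a] \<in> short_subseqs m (u @ [a])"
    using snoc.prems(2) by (simp add: short_subseqs_def)
  then have "s @ [a] \<in> short_subseqs m u" using snoc.prems(1)[of a] by simp
  then show ?case by (simp add: short_subseqs_def)
qed

text \<open>Since \<open>m\<close> letters always spell some forbidden word, \<open>m\<close> redundant letters would put that
  word into \<open>u\<close> already.  That any \<open>m\<close> letters do so is all that the upper bound uses of a pattern.\<close>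

lemma few_redundant_letters:
  assumes "finite A"
    and P: "\<And>M. M \<subseteq> A \<Longrightarrow> card M = m \<Longrightarrow> \<exists>t\<in>P. set t = M \<and> length t = m"
    and avoid: "\<forall>t\<in>P. \<not> subseq t u"
  shows "card {a \<in> A. short_subseqs m (u @ [a]) = short_subseqs m u} < m"
proof (rule ccontr)
  let ?R = "{a \<in> A. short_subseqs m (u @ [a]) = short_subseqs m u}"
  assume "\<not> ?thesis"
  then have "m \<le> card ?R" by simp
  then obtain M where M: "M \<subseteq> ?R" "card M = m"
    by (rule obtain_subset_with_card_n)
  then have "M \<subseteq> A" by blast
  then obtain t where t: "t \<in> P" "set t = M" "length t = m" using P[of M] M(2) by blast
  have "subseq t u"
  proof (rule subseq_of_redundant_letters)
    show "short_subseqs m (u @ [a]) = short_subseqs m u" if "a \<in> set t" for a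
      using that t(2) M(1) by blast
    show "length t \<le> m" using t(3) by simp
  qed
  then show False using avoid \<open>t \<in> P\<close> by blast
qed

lemma card_avoiding_extensions_Suc:
  assumes "finite A"
  shows "card (avoiding_extensions A P u (Suc n)) \<le>
         (\<Sum>a\<in>A. card (avoiding_extensions A P (u @ [a]) n))"
proof -
  have "avoiding_extensions A P u (Suc n) \<subseteq>
        (\<Union>a\<in>A. Cons a ` avoiding_extensions A P (u @ [a]) n)"
  proof
    fix v assume "v \<in> avoiding_extensions A P u (Suc n)"
    then show "v \<in> (\<Union>a\<in>A. Cons a ` avoiding_extensions A P (u @ [a]) n)"
      by (cases v) (auto simp: avoiding_extensions_def)
  qed
  then have "card (avoiding_extensions A P u (Suc n)) \<le>
             card (\<Union>a\<in>A. Cons a ` avoiding_extensions A P (u @ [a]) n)"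
    by (rule card_mono[rotated]) (simp add: assms finite_avoiding_extensions)
  also have "\<dots> \<le> (\<Sum>a\<in>A. card (Cons a ` avoiding_extensions A P (u @ [a]) n))"
    by (rule card_UN_le[OF assms])
  also have "\<dots> = (\<Sum>a\<in>A. card (avoiding_extensions A P (u @ [a]) n))"
    by (simp add: card_image)
  finally show ?thesis .
qed

text \<open>Induction on \<open>n\<close>, with a weight \<open>c\<close> for every short sequence that has not yet occurred.  A
  first letter of an extension is either one of at most \<open>m - 1\<close> redundant ones, which leave the
  weight unchanged, or one of at most \<open>card A\<close> others, which cost at least one factor \<open>c\<close>.  As
  \<open>card A / c \<le> e\<close>, all the others together count for at most \<open>e\<close> redundant letters.\<close>

lemma card_avoiding_extensions_le:
  fixes e :: real
  assumes "finite A" and "m \<ge> 1" and "e > 0"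
    and P: "\<And>M. M \<subseteq> A \<Longrightarrow> card M = m \<Longrightarrow> \<exists>t\<in>P. set t = M \<and> length t = m"
    and c: "c \<ge> 1" "real (card A) \<le> e * c"
    and "set u \<subseteq> A"
  shows "real (card (avoiding_extensions A P u n)) \<le>
    c ^ card ({t. set t \<subseteq> A \<and> length t \<le> m} - short_subseqs m u) * (real m - 1 + e) ^ n"
  using \<open>set u \<subseteq> A\<close>
proof (induction n arbitrary: u)
  case 0
  have "avoiding_extensions A P u 0 \<subseteq> {[]}" by (auto simp: avoiding_extensions_def)
  then have "card (avoiding_extensions A P u 0) \<le> 1"
    using card_mono[of "{[]::'a list}"] by simp
  then have "real (card (avoiding_extensions A P u 0)) \<le> 1" by simp
  also have "1 \<le> c ^ card ({t. set t \<subseteq> A \<and> length t \<le> m} - short_subseqs m u)"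
    by (rule one_le_power[OF c(1)])
  finally show ?case by simp
next
  case (Suc n)
  let ?T = "{t. set t \<subseteq> A \<and> length t \<le> m}"
  let ?d = "\<lambda>u. card (?T - short_subseqs m u)"
  let ?r = "real m - 1 + e"
  let ?F = "\<lambda>a. real (card (avoiding_extensions A P (u @ [a]) n))"
  have r: "?r > 0" using \<open>m \<ge> 1\<close> \<open>e > 0\<close> by simp
  have finT: "finite ?T" by (rule finite_lists_length_le[OF \<open>finite A\<close>])
  show ?case
  proof (cases "\<forall>t\<in>P. \<not> subseq t u")
    case False
    then have "avoiding_extensions A P u (Suc n) = {}"
      by (auto simp: avoiding_extensions_def)
    then show ?thesis using c(1) r by simp
  next
    case True
    define R where "R = {a \<in> A. short_subseqs m (u @ [a]) = short_subseqs m u}"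
    have R: "R \<subseteq> A" "card R < m"
    proof -
      show "R \<subseteq> A" by (auto simp: R_def)
      show "card R < m"
        unfolding R_def by (rule few_redundant_letters[OF \<open>finite A\<close> _ True]) (rule P)
    qed
    have redundant: "?F a \<le> c ^ ?d u * ?r ^ n" if "a \<in> R" for a
      using Suc.IH[of "u @ [a]"] that Suc.prems by (simp add: R_def)
    have new: "c * ?F a \<le> c ^ ?d u * ?r ^ n" if a: "a \<in> A - R" for a
    proof -
      have grows: "short_subseqs m u \<subset> short_subseqs m (u @ [a])"
        using a short_subseqs_snoc_mono[of m u a] by (auto simp: R_def)
      have sub: "short_subseqs m (u @ [a]) \<subseteq> ?T"
      proof
        fix t assume "t \<in> short_subseqs m (u @ [a])"
        then have t: "subseq t (u @ [a])" "length t \<le> m" by (simp_all add: short_subseqs_def)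
        have "set t \<subseteq> set (u @ [a])" using list_emb_set[OF t(1)] by blast
        then show "t \<in> ?T" using Suc.prems a t(2) by auto
      qed
      have "?T - short_subseqs m (u @ [a]) \<subset> ?T - short_subseqs m u"
        using grows sub by blast
      then have less: "Suc (?d (u @ [a])) \<le> ?d u"
        using psubset_card_mono[OF finite_Diff[OF finT]] by (simp add: Suc_le_eq)
      have "?F a \<le> c ^ ?d (u @ [a]) * ?r ^ n"
        using Suc.IH[of "u @ [a]"] a Suc.prems by simp
      then have "c * ?F a \<le> c ^ Suc (?d (u @ [a])) * ?r ^ n"
        using c(1) by (simp add: mult.assoc)
      also have "\<dots> \<le> c ^ ?d u * ?r ^ n"
        using r by (intro mult_right_mono power_increasing[OF less c(1)]) simp
      finally show ?thesis .
    qed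
    have "real (card (avoiding_extensions A P u (Suc n))) \<le> (\<Sum>a\<in>A. ?F a)"
      using card_avoiding_extensions_Suc[OF \<open>finite A\<close>, of P u n]
      by (metis of_nat_mono of_nat_sum)
    moreover have "(\<Sum>a\<in>A. ?F a) = (\<Sum>a\<in>R. ?F a) + (\<Sum>a\<in>A - R. ?F a)"
      using sum.subset_diff[OF R(1) \<open>finite A\<close>] by (simp add: add.commute)
    moreover have "(\<Sum>a\<in>R. ?F a) \<le> (real m - 1) * (c ^ ?d u * ?r ^ n)"
    proof -
      have "(\<Sum>a\<in>R. ?F a) \<le> real (card R) * (c ^ ?d u * ?r ^ n)"
        by (rule sum_bounded_above[OF redundant])
      also have "\<dots> \<le> (real m - 1) * (c ^ ?d u * ?r ^ n)"
        using R(2) r c(1) by (intro mult_right_mono) auto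
      finally show ?thesis .
    qed
    moreover have "(\<Sum>a\<in>A - R. ?F a) \<le> e * (c ^ ?d u * ?r ^ n)"
    proof -
      have "c * (\<Sum>a\<in>A - R. ?F a) \<le> real (card (A - R)) * (c ^ ?d u * ?r ^ n)"
        unfolding sum_distrib_left by (rule sum_bounded_above[OF new])
      also have "\<dots> \<le> (e * c) * (c ^ ?d u * ?r ^ n)"
        using c r card_mono[of A "A - R"] \<open>finite A\<close>
        by (intro mult_right_mono) auto
      finally have "c * (\<Sum>a\<in>A - R. ?F a) \<le> c * (e * (c ^ ?d u * ?r ^ n))"
        by (simp add: mult_ac)
      then show ?thesis using c(1) by simp
    qed
    moreover have "(real m - 1) * (c ^ ?d u * ?r ^ n) + e * (c ^ ?d u * ?r ^ n) = c ^ ?d u * ?r ^ Suc n"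
      by (simp add: algebra_simps)
    ultimately show ?thesis by linarith
  qed
qed

lemma card_avoiding_words_le:
  fixes r :: real
  assumes "finite A" and "m \<ge> 1" and "r > real m - 1"
    and P: "\<And>M. M \<subseteq> A \<Longrightarrow> card M = m \<Longrightarrow> \<exists>t\<in>P. set t = M \<and> length t = m"
  shows "\<exists>C>0. \<forall>n. real (card {w. set w \<subseteq> A \<and> length w = n \<and> (\<forall>t\<in>P. \<not> subseq t w)}) \<le> C * r ^ n"
proof -
  define e where "e = r - (real m - 1)"
  define c where "c = max 1 (real (card A) / e)"
  have e: "e > 0" using assms by (simp add: e_def)
  have c: "c \<ge> 1" "real (card A) \<le> e * c"
    using e by (auto simp: c_def max_def field_simps)
  define C where "C = c ^ card ({t. set t \<subseteq> A \<and> length t \<le> m} - short_subseqs m [])"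
  have "real (card (avoiding_extensions A P [] n)) \<le> C * r ^ n" for n
    using card_avoiding_extensions_le[OF assms(1,2) e P c, of "[]" n] by (simp add: e_def C_def)
  then show ?thesis using c(1) by (intro exI[of _ C]) (simp add: C_def avoiding_extensions_def)
qed

section \<open>Ordered partitions as words\<close>

text \<open>Elements of \<open>{1..n}\<close> are counted from 1, positions of a word and its letters from 0.\<close>

definition blocks :: "nat \<Rightarrow> nat list \<Rightarrow> nat set list" where
  "blocks k w = map (\<lambda>j. {x. 1 \<le> x \<and> x \<le> length w \<and> w ! (x - 1) = j}) [0..<k]"

lemma length_blocks [simp]: "length (blocks k w) = k"
  by (simp add: blocks_def)

lemma in_blocks_nth_iff:
  "j < k \<Longrightarrow> x \<in> blocks k w ! j \<longleftrightarrow> 1 \<le> x \<and> x \<le> length w \<and> w ! (x - 1) = j"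
  by (simp add: blocks_def)

lemma blocks_in_ordered_partitions:
  assumes "set w = {..<k}"
  shows "blocks k w \<in> ordered_partitions (length w) k"
proof -
  have nonempty: "blocks k w ! j \<noteq> {}" if "j < k" for j
  proof -
    have "j \<in> set w" using that assms by simp
    then obtain x where "x < length w" "w ! x = j" unfolding in_set_conv_nth by blast
    then have "Suc x \<in> blocks k w ! j" using that by (simp add: in_blocks_nth_iff)
    then show ?thesis by blast
  qed
  have disj: "i = j" if "i < k" "j < k" "x \<in> blocks k w ! i" "x \<in> blocks k w ! j" for i j x
    using that by (simp add: in_blocks_nth_iff)
  have "distinct (blocks k w)"
    unfolding distinct_conv_nth length_blocks
  proof (intro allI impI)
    fix i j assume ij: "i < k" "j < k" "i \<noteq> j"
    obtain x where "x \<in> blocks k w ! i" using nonempty[OF ij(1)] by blast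
    then show "blocks k w ! i \<noteq> blocks k w ! j" using disj[OF ij(1,2)] ij(3) by auto
  qed
  moreover have "partition_on {1..length w} (set (blocks k w))"
  proof (rule partition_onI)
    show "\<Union> (set (blocks k w)) = {1..length w}"
    proof (intro equalityI subsetI)
      fix x assume "x \<in> \<Union> (set (blocks k w))"
      then show "x \<in> {1..length w}" by (auto simp: blocks_def)
    next
      fix x assume x: "x \<in> {1..length w}"
      then have "w ! (x - 1) \<in> set w" by (intro nth_mem) auto
      then have "w ! (x - 1) < k" using assms by auto
      then have "x \<in> blocks k w ! (w ! (x - 1))" using x by (simp add: in_blocks_nth_iff)
      with \<open>w ! (x - 1) < k\<close> show "x \<in> \<Union> (set (blocks k w))"
        using nth_mem[of "w ! (x - 1)" "blocks k w"] by auto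
    qed
    show "disjnt p q" if "p \<in> set (blocks k w)" "q \<in> set (blocks k w)" "p \<noteq> q" for p q
    proof -
      obtain i j where "i < k" "p = blocks k w ! i" "j < k" "q = blocks k w ! j"
        using \<open>p \<in> _\<close> \<open>q \<in> _\<close> by (auto simp: in_set_conv_nth)
      then show ?thesis using disj \<open>p \<noteq> q\<close> by (auto simp: disjnt_iff)
    qed
    show "{} \<notin> set (blocks k w)"
      using nonempty by (auto simp: in_set_conv_nth)
  qed
  ultimately show ?thesis by (simp add: ordered_partitions_def)
qed

lemma ordered_partition_eq_blocks:
  assumes "B \<in> ordered_partitions n k"
  obtains w where "length w = n" "set w \<subseteq> {..<k}" "B = blocks k w"
proof -
  have len: "length B = k" and dist: "distinct B" and un: "\<Union>(set B) = {1..n}"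
    and disj: "disjoint (set B)"
    using assms by (auto simp: ordered_partitions_def partition_on_def)
  have "\<exists>j<k. x \<in> B ! j" if "x \<in> {1..n}" for x
    using that un len by (metis UnionE in_set_conv_nth)
  then obtain f where f: "\<And>x. x \<in> {1..n} \<Longrightarrow> f x < k \<and> x \<in> B ! f x" by metis
  have uniq: "f x = j" if "x \<in> {1..n}" "j < k" "x \<in> B ! j" for x j
  proof -
    have "B ! f x = B ! j"
      using disj f[OF that(1)] that len unfolding disjoint_def
      by (metis IntI empty_iff nth_mem)
    then show ?thesis using dist f[OF that(1)] that(2) len by (simp add: nth_eq_iff_index_eq)
  qed
  define w where "w = map (\<lambda>y. f (Suc y)) [0..<n]"
  have "B = blocks k w"
  proof (rule nth_equalityI)
    show "length B = length (blocks k w)" by (simp add: len)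
    fix j assume j: "j < length B"
    have "x \<in> B ! j \<longleftrightarrow> x \<in> blocks k w ! j" for x
    proof (cases "x \<in> {1..n}")
      case True
      then have "w ! (x - 1) = f x" "length w = n" by (auto simp: w_def)
      then show ?thesis using True uniq[OF True] f[OF True] j len by (auto simp: in_blocks_nth_iff)
    next
      case False
      then have "x \<notin> B ! j" using un j nth_mem by blast
      moreover have "x \<notin> blocks k w ! j"
        using False j len by (auto simp: in_blocks_nth_iff w_def)
      ultimately show ?thesis by blast
    qed
    then show "B ! j = blocks k w ! j" by blast
  qed
  moreover have "length w = n" "set w \<subseteq> {..<k}" using f by (auto simp: w_def)
  ultimately show thesis using that by blast
qed

lemma inj_on_blocks: "inj_on (blocks k) {w. length w = n \<and> set w \<subseteq> {..<k}}"
proof (rule inj_onI)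
  fix v w assume v: "v \<in> {w. length w = n \<and> set w \<subseteq> {..<k}}"
    and w: "w \<in> {w. length w = n \<and> set w \<subseteq> {..<k}}" and eq: "blocks k v = blocks k w"
  show "v = w"
  proof (rule nth_equalityI)
    show "length v = length w" using v w by simp
    fix x assume x: "x < length v"
    then have "v ! x < k" using v nth_mem by fastforce
    then have "Suc x \<in> blocks k v ! (v ! x)" using x by (simp add: in_blocks_nth_iff)
    then show "v ! x = w ! x" using \<open>v ! x < k\<close> unfolding eq by (simp add: in_blocks_nth_iff)
  qed
qed

section \<open>The upper bound\<close>

lemma pattern_positions_bij:
  assumes "is_pattern p"
  shows "bij_betw (\<lambda>j. p ! j - 1) {..<length p} {..<length p}"
proof -
  have p: "set p = {1..length p}" "distinct p"
    using assms by (auto simp: is_pattern_def permutations_of_set_def)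
  have mem: "1 \<le> p ! j \<and> p ! j \<le> length p" if "j < length p" for j
    using p(1) nth_mem[OF that] by auto
  have "inj_on (\<lambda>j. p ! j - 1) {..<length p}"
  proof (rule inj_onI)
    fix i j assume ij: "i \<in> {..<length p}" "j \<in> {..<length p}" "p ! i - 1 = p ! j - 1"
    then have "p ! i = p ! j" using mem[of i] mem[of j] by (simp; linarith)
    then show "i = j" using ij p(2) by (simp add: nth_eq_iff_index_eq)
  qed
  moreover have "(\<lambda>j. p ! j - 1) ` {..<length p} \<subseteq> {..<length p}"
    using mem by fastforce
  ultimately show ?thesis
    by (simp add: bij_betw_def endo_inj_surj)
qed

text \<open>The words order isomorphic to the inverse of \<open>p\<close>: reading the letters in the order in which
  \<open>p\<close> lists their positions makes them increase.  Positions in \<open>p\<close> stand for blocks and entries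
  of \<open>p\<close> for elements, whereas in a word positions are elements and letters are blocks.\<close>

definition inverse_occurrences :: "nat list \<Rightarrow> nat list set" where
  "inverse_occurrences p =
     {t. length t = length p \<and> strict_mono_on {..<length p} (\<lambda>j. t ! (p ! j - 1))}"

lemma ex_inverse_occurrence:
  assumes "is_pattern p" and "finite M" and "card M = length p"
  shows "\<exists>t\<in>inverse_occurrences p. set t = M \<and> length t = length p"
proof -
  let ?m = "length p" and ?h = "\<lambda>j. p ! j - 1"
  define xs where "xs = sorted_list_of_set M"
  have xs: "sorted_wrt (<) xs" "set xs = M" "length xs = ?m"
    using assms by (auto simp: xs_def)
  have bij: "bij_betw ?h {..<?m} {..<?m}" by (rule pattern_positions_bij[OF assms(1)])
  define t where "t = map (\<lambda>v. xs ! inv_into {..<?m} ?h v) [0..<?m]"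
  have nth_t: "t ! (p ! j - 1) = xs ! j" if "j < ?m" for j
  proof -
    have "?h j < ?m" using bij that by (auto dest: bij_betwE)
    then show ?thesis
      using bij_betw_inv_into_left[OF bij] that by (simp add: t_def)
  qed
  have "strict_mono_on {..<?m} (\<lambda>j. t ! (p ! j - 1))"
    using xs(1,3) nth_t by (intro strict_mono_onI) (auto simp: sorted_wrt_nth_less)
  moreover have "set t = M"
  proof -
    have "set t = (!) xs ` inv_into {..<?m} ?h ` {..<?m}"
      by (simp add: t_def image_image atLeast0LessThan)
    also have "inv_into {..<?m} ?h ` {..<?m} = {..<?m}"
      using bij_betw_inv_into[OF bij] by (simp add: bij_betw_def)
    also have "(!) xs ` {..<?m} = M"
      using xs(2,3) by (auto simp: set_conv_nth)
    finally show ?thesis .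
  qed
  ultimately show ?thesis
    by (intro bexI[of _ t]) (auto simp: inverse_occurrences_def t_def)
qed

lemma subseq_imp_positions:
  assumes "subseq xs ys"
  shows "\<exists>g. strict_mono_on {..<length xs} g \<and> (\<forall>v<length xs. g v < length ys \<and> ys ! g v = xs ! v)"
  using assms
proof (induction rule: list_emb.induct)
  case (list_emb_Nil ys)
  then show ?case by (auto simp: strict_mono_on_def)
next
  case (list_emb_Cons xs ys y)
  then obtain g where "strict_mono_on {..<length xs} g"
    "\<forall>v<length xs. g v < length ys \<and> ys ! g v = xs ! v" by blast
  then show ?case by (intro exI[of _ "\<lambda>v. Suc (g v)"]) (auto simp: strict_mono_on_def)
next
  case (list_emb_Cons2 x y xs ys)
  then obtain g where g: "strict_mono_on {..<length xs} g"
    "\<forall>v<length xs. g v < length ys \<and> ys ! g v = xs ! v" by blast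
  then show ?case using list_emb_Cons2(1)
    by (intro exI[of _ "\<lambda>v. case v of 0 \<Rightarrow> 0 | Suc u \<Rightarrow> Suc (g u)"])
       (auto simp: strict_mono_on_def nth_Cons split: nat.splits)
qed

lemma contains_pattern_blocks:
  assumes "is_pattern p" and "t \<in> inverse_occurrences p" and "subseq t w" and "set w \<subseteq> {..<k}"
  shows "contains_pattern (blocks k w) p"
proof -
  let ?m = "length p" and ?h = "\<lambda>j. p ! j - 1"
  have t: "length t = ?m" "strict_mono_on {..<?m} (\<lambda>j. t ! ?h j)"
    using assms(2) by (auto simp: inverse_occurrences_def)
  obtain g where g: "strict_mono_on {..<?m} g" "\<And>v. v < ?m \<Longrightarrow> g v < length w \<and> w ! g v = t ! v"
    using subseq_imp_positions[OF assms(3)] t(1) by auto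
  have h: "?h j < ?m" if "j < ?m" for j
    using pattern_positions_bij[OF assms(1)] that by (auto dest: bij_betwE)
  have pos: "1 \<le> p ! j" if "j < ?m" for j
    using assms(1) nth_mem[OF that] by (auto simp: is_pattern_def permutations_of_set_def)
  have "t ! ?h j < k \<and> Suc (g (?h j)) \<in> blocks k w ! (t ! ?h j)" if "j < ?m" for j
  proof -
    have "w ! g (?h j) < k" using g(2)[OF h[OF that]] assms(4) nth_mem by fastforce
    then show ?thesis using g(2)[OF h[OF that]] by (simp add: in_blocks_nth_iff)
  qed
  moreover have "Suc (g (?h i)) < Suc (g (?h j)) \<longleftrightarrow> p ! i < p ! j" if "i < ?m" "j < ?m" for i j
    using strict_mono_on_less[OF g(1), of "?h i" "?h j"] h that pos[OF that(1)] pos[OF that(2)] by auto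
  ultimately show ?thesis
    unfolding contains_pattern_def using t(2)
    by (intro exI[of _ "\<lambda>j. t ! ?h j"] exI[of _ "\<lambda>j. Suc (g (?h j))"]) simp
qed

lemma op_count_upper:
  assumes "is_pattern p" and "r > real (length p) - 1"
  shows "\<exists>C>0. \<forall>n. real (op_count n k p) \<le> C * r ^ n"
proof -
  let ?W = "\<lambda>n. {w. set w \<subseteq> {..<k} \<and> length w = n \<and> (\<forall>t\<in>inverse_occurrences p. \<not> subseq t w)}"
  have "op_count n k p \<le> card (?W n)" for n
  proof -
    have fin: "finite (?W n)"
      by (rule finite_subset[OF _ finite_lists_length_eq[of "{..<k}" n]]) auto
    have "{B \<in> ordered_partitions n k. \<not> contains_pattern B p} \<subseteq> blocks k ` ?W n"
    proof
      fix B assume B: "B \<in> {B \<in> ordered_partitions n k. \<not> contains_pattern B p}"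
      then obtain w where "length w = n" "set w \<subseteq> {..<k}" "B = blocks k w"
        using ordered_partition_eq_blocks by blast
      then show "B \<in> blocks k ` ?W n" using B contains_pattern_blocks[OF assms(1)] by blast
    qed
    then show ?thesis
      unfolding op_count_def using fin by (meson card_image_le card_mono finite_imageI le_trans)
  qed
  moreover have "\<exists>C>0. \<forall>n. real (card (?W n)) \<le> C * r ^ n"
  proof (rule card_avoiding_words_le)
    show "1 \<le> length p" using assms(1) by (simp add: is_pattern_def)
    show "\<exists>t\<in>inverse_occurrences p. set t = M \<and> length t = length p"
      if "M \<subseteq> {..<k}" "card M = length p" for M
      using ex_inverse_occurrence[OF assms(1)] that finite_subset by blast
  qed (use assms(2) in auto)
  ultimately show ?thesis by (meson of_nat_mono order_trans)
qed

section \<open>The lower bound\<close>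

lemma le_strict_mono_on_lessThan:
  fixes i :: "nat \<Rightarrow> nat"
  assumes "strict_mono_on {..<m} i" and "j < m"
  shows "j \<le> i j"
  using assms(2)
proof (induction j)
  case (Suc j)
  then show ?case using strict_mono_onD[OF assms(1), of j "Suc j"] by simp
qed simp

text \<open>An occurrence of \<open>p\<close> in the partition as positions \<open>g\<close> in the word; \<open>i j\<close> is both the
  block used for the entry \<open>j\<close> of \<open>p\<close> and the letter found there.\<close>

lemma contains_pattern_blocksE:
  assumes "contains_pattern (blocks k w) p"
  obtains i g where "strict_mono_on {..<length p} i"
    and "\<forall>j<length p. g j < length w \<and> w ! g j = i j"
    and "\<forall>s<length p. \<forall>t<length p. g s < g t \<longleftrightarrow> p ! s < p ! t"
proof -
  obtain i b where ib: "strict_mono_on {..<length p} i"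
    "\<forall>j<length p. i j < k \<and> b j \<in> blocks k w ! i j"
    "\<forall>s<length p. \<forall>t<length p. b s < b t \<longleftrightarrow> p ! s < p ! t"
    using assms by (auto simp: contains_pattern_def)
  have b: "1 \<le> b j \<and> b j \<le> length w \<and> w ! (b j - 1) = i j" if "j < length p" for j
    using ib(2) that in_blocks_nth_iff by blast
  show thesis
  proof (rule that[of i "\<lambda>j. b j - 1"])
    show "\<forall>j<length p. b j - 1 < length w \<and> w ! (b j - 1) = i j"
      using b by fastforce
    show "\<forall>s<length p. \<forall>t<length p. b s - 1 < b t - 1 \<longleftrightarrow> p ! s < p ! t"
    proof (intro allI impI)
      fix s t assume st: "s < length p" "t < length p"
      have "b s - 1 < b t - 1 \<longleftrightarrow> b s < b t" using b[OF st(1)] b[OF st(2)] by linarith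
      then show "b s - 1 < b t - 1 \<longleftrightarrow> p ! s < p ! t" using ib(3) st by simp
    qed
  qed (rule ib(1))
qed

text \<open>The last entry of \<open>p\<close> is matched by a letter too large for \<open>v\<close>, so in the prefix; a smaller
  entry \<open>p ! s\<close> is then matched further left in the prefix, by a larger letter.  But entry \<open>s\<close>
  comes before the last one in \<open>p\<close> and needs a smaller letter.\<close>

lemma avoids_decreasing_prefix:
  assumes "s < length p - 1" and "p ! s < p ! (length p - 1)" and v: "set v \<subseteq> {..<length p - 1}"
  shows "\<not> contains_pattern (blocks k (rev [0..<k] @ v)) p"
proof
  let ?l = "length p - 1" and ?w = "rev [0..<k] @ v"
  assume "contains_pattern (blocks k ?w) p"
  then obtain i g where i: "strict_mono_on {..<length p} i"
    and g: "\<forall>j<length p. g j < length ?w \<and> ?w ! g j = i j"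
    and iso: "\<forall>s<length p. \<forall>t<length p. g s < g t \<longleftrightarrow> p ! s < p ! t"
    by (rule contains_pattern_blocksE)
  have l: "?l < length p" "s < length p" using assms(1) by auto
  have "?l \<le> ?w ! g ?l" using le_strict_mono_on_lessThan[OF i l(1)] g l(1) by simp
  have "g ?l < k"
  proof (rule ccontr)
    assume "\<not> g ?l < k"
    moreover have "g ?l < length ?w" using g[rule_format, OF l(1)] by (rule conjunct1)
    ultimately have "?w ! g ?l \<in> set v" by (simp add: nth_append)
    then show False using v \<open>?l \<le> ?w ! g ?l\<close> by auto
  qed
  moreover have "g s < g ?l" using iso l assms(2) by simp
  moreover have "?w ! g s < ?w ! g ?l"
    using strict_mono_onD[OF i, of s ?l] assms(1) g l(1) g l(2) by simp
  ultimately show False by (auto simp: nth_append rev_nth)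
qed

text \<open>The mirror image: a larger entry is matched further right in the increasing suffix, again
  by a larger letter.\<close>

lemma avoids_increasing_suffix:
  assumes "s < length p - 1" and "p ! s > p ! (length p - 1)" and v: "set v \<subseteq> {..<length p - 1}"
  shows "\<not> contains_pattern (blocks k (v @ [0..<k])) p"
proof
  let ?l = "length p - 1" and ?w = "v @ [0..<k]"
  assume "contains_pattern (blocks k ?w) p"
  then obtain i g where i: "strict_mono_on {..<length p} i"
    and g: "\<forall>j<length p. g j < length ?w \<and> ?w ! g j = i j"
    and iso: "\<forall>s<length p. \<forall>t<length p. g s < g t \<longleftrightarrow> p ! s < p ! t"
    by (rule contains_pattern_blocksE)
  have l: "?l < length p" "s < length p" using assms(1) by auto
  have "?l \<le> ?w ! g ?l" using le_strict_mono_on_lessThan[OF i l(1)] g l(1) by simp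
  have "length v \<le> g ?l"
  proof (rule ccontr)
    assume "\<not> length v \<le> g ?l"
    then have "?w ! g ?l \<in> set v" by (simp add: nth_append)
    then show False using v \<open>?l \<le> ?w ! g ?l\<close> by auto
  qed
  moreover have "g ?l < g s" using iso l assms(2) by simp
  moreover have "?w ! g s < ?w ! g ?l"
    using strict_mono_onD[OF i, of s ?l] assms(1) g l(1) g l(2) by simp
  ultimately show False using g l(1) g l(2) by (auto simp: nth_append)
qed

lemma op_count_lower:
  assumes p: "is_pattern p" and "length p \<ge> 2" and "k \<ge> length p" and "n \<ge> k"
  shows "(length p - 1) ^ (n - k) \<le> op_count n k p"
proof -
  let ?l = "length p - 1"
  let ?V = "{v. set v \<subseteq> {..<?l} \<and> length v = n - k}"
  \<comment> \<open>The two insertions of all \<open>k\<close> letters into a word are treated alike from here on; they also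
    make every block nonempty.\<close>
  obtain F :: "nat list \<Rightarrow> nat list" where
    F: "inj F" "\<And>v. length (F v) = k + length v" "\<And>v. set (F v) = {..<k} \<union> set v"
      "\<And>v. set v \<subseteq> {..<?l} \<Longrightarrow> \<not> contains_pattern (blocks k (F v)) p"
  proof -
    have "distinct p" using p by (simp add: is_pattern_def permutations_of_set_def)
    then have "p ! 0 \<noteq> p ! ?l" using \<open>length p \<ge> 2\<close> by (subst nth_eq_iff_index_eq) auto
    then consider "p ! 0 < p ! ?l" | "p ! 0 > p ! ?l" by linarith
    then show thesis
    proof cases
      case 1
      show thesis
      proof (rule that[of "\<lambda>v. rev [0..<k] @ v"])
        show "inj (\<lambda>v. rev [0..<k] @ v)" by (simp add: inj_on_def)
        show "\<not> contains_pattern (blocks k (rev [0..<k] @ v)) p" if "set v \<subseteq> {..<?l}" for v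
          by (rule avoids_decreasing_prefix[OF _ 1 that]) (use \<open>length p \<ge> 2\<close> in simp)
      qed auto
    next
      case 2
      show thesis
      proof (rule that[of "\<lambda>v. v @ [0..<k]"])
        show "inj (\<lambda>v. v @ [0..<k])" by (simp add: inj_on_def)
        show "\<not> contains_pattern (blocks k (v @ [0..<k])) p" if "set v \<subseteq> {..<?l}" for v
          by (rule avoids_increasing_suffix[OF _ 2 that]) (use \<open>length p \<ge> 2\<close> in simp)
      qed auto
    qed
  qed
  have V: "length (F v) = n \<and> set (F v) = {..<k}" if "v \<in> ?V" for v
    using that F(2,3) \<open>n \<ge> k\<close> \<open>k \<ge> length p\<close> by auto
  have "inj_on (blocks k \<circ> F) ?V"
  proof (rule comp_inj_on)
    show "inj_on F ?V" using F(1) by (rule inj_on_subset) simp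
    show "inj_on (blocks k) (F ` ?V)"
      by (rule inj_on_subset[OF inj_on_blocks[of k n]]) (use V in auto)
  qed
  then have "card ?V = card ((blocks k \<circ> F) ` ?V)" by (rule card_image[symmetric])
  also have "\<dots> \<le> op_count n k p"
    unfolding op_count_def
  proof (rule card_mono)
    show "finite {B \<in> ordered_partitions n k. \<not> contains_pattern B p}"
      using finite_ordered_partitions by simp
    show "(blocks k \<circ> F) ` ?V \<subseteq> {B \<in> ordered_partitions n k. \<not> contains_pattern B p}"
    proof safe
      fix v assume v: "set v \<subseteq> {..<?l}" "length v = n - k"
      then show "(blocks k \<circ> F) v \<in> ordered_partitions n k"
        using V[of v] blocks_in_ordered_partitions[of "F v" k] by simp
      show "contains_pattern ((blocks k \<circ> F) v) p \<Longrightarrow> False"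
        using F(4)[OF v(1)] by simp
    qed
  qed
  finally show ?thesis by (simp add: card_lists_length_eq)
qed

section \<open>The growth rate\<close>

theorem theorem2p3:
  fixes p :: "nat list" and k :: nat
  assumes "is_pattern p" and "k \<ge> length p"
  shows "(\<lambda>n. root n (real (op_count n k p))) \<longlonglongrightarrow> real (length p) - 1"
proof -
  have m: "length p \<ge> 1" using assms(1) by (simp add: is_pattern_def)
  have "\<exists>c>0. \<forall>\<^sub>F n in sequentially. c * (real (length p) - 1) ^ n \<le> real (op_count n k p)"
  proof (cases "length p = 1")
    case True
    \<comment> \<open>The base is 0: its powers vanish for \<open>n > 0\<close>, but at \<open>n = 0\<close> the power is 1.\<close>
    then show ?thesis
      by (intro exI[of _ 1] conjI eventually_mono[OF eventually_gt_at_top[of 0]])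
         (simp_all add: zero_power)
  next
    case False
    then have m2: "length p \<ge> 2" using m by simp
    let ?l = "real (length p) - 1"
    have "1 / ?l ^ k * ?l ^ n \<le> real (op_count n k p)" if "n \<ge> k" for n
    proof -
      have "?l \<noteq> 0" using m2 by simp
      then have "1 / ?l ^ k * ?l ^ n = ?l ^ (n - k)"
        using power_diff[OF _ that, of ?l] by simp
      also have "\<dots> = real ((length p - 1) ^ (n - k))" using m by (simp add: of_nat_diff)
      also have "\<dots> \<le> real (op_count n k p)"
        using op_count_lower[OF assms(1) m2 assms(2) that] by (rule of_nat_mono)
      finally show ?thesis .
    qed
    then have "\<forall>\<^sub>F n in sequentially. 1 / ?l ^ k * ?l ^ n \<le> real (op_count n k p)"
      by (rule eventually_sequentiallyI)
    moreover have "1 / ?l ^ k > 0" using m2 by simp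
    ultimately show ?thesis by blast
  qed
  then obtain c where c: "c > 0"
    "\<forall>\<^sub>F n in sequentially. c * (real (length p) - 1) ^ n \<le> real (op_count n k p)" by blast
  show ?thesis
  proof (rule root_tendsto_growth_rate[OF _ c])
    show "0 \<le> real (length p) - 1" using m by simp
  qed (rule op_count_upper[OF assms(1)])
qed

end
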